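(* There are type $A$ crystal poset intervals with arbitrarily large Möbius function: for every integer $N$ there exist $n$, a partition $\lambda$, and elements $u\le v$ of the type $A_{n-1}$ crystal poset $B(\lambda)$ with $\mu(u,v)\ge N$.
   Context: The type $A_{n-1}$ crystal poset $B(\lambda)$ is the set of semistandard Young tableaux of shape $\lambda$ with entries in $\{1,\dots,n\}$, partially ordered by the transitive closure of $T\lessdot f_i(T)$, where $f_i$ is the crystal operator given by the signature rule: read the entries $i$ and $i+1$ of $T$ column by column from left to right, bottom to top within a column, write $+$ for $i$ and $-$ for $i+1$, repeatedly cancel adjacent pairs $-+$ to obtain $+^x-^y$; if $x>0$, $f_i(T)$ changes the $i$ corresponding to the rightmost uncancelled $+$ into $i+1$ (otherwise $f_i(T)=\mathbf 0$). $\mu$ denotes the Möbius function of this poset. *)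

theory Defs
  imports Main
begin

section \<open>The Moebius function of a locally finite poset\<close>

text \<open>
  A poset is a relation \<open>r\<close> that is a partial order on its field. The value is 0 for pairs
  that are not comparable, and by convention also when \<open>r\<close> is not a partial order or the
  interval is infinite; these guards only serve to make the recursion terminate.
\<close>

definition interval :: "'a rel \<Rightarrow> 'a \<Rightarrow> 'a \<Rightarrow> 'a set" where
  "interval r x y = {z. (x, z) \<in> r \<and> (z, y) \<in> r}"

function mobius :: "'a rel \<Rightarrow> 'a \<Rightarrow> 'a \<Rightarrow> int" where
  "mobius r x y =
     (if Partial_order r \<and> finite (interval r x y) \<and> (x, y) \<in> r
      then if x = y then 1 else - (\<Sum>z \<in> interval r x y - {y}. mobius r x z)
      else 0)"
  by pat_completeness auto
termination
proof (relation "measure (\<lambda>(r, x, y). card (interval r x y))", goal_cases)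
  case (2 r x y z)
  then have po: "Partial_order r" and fin: "finite (interval r x y)" and xy: "(x, y) \<in> r"
    and zy: "(z, y) \<in> r" "z \<noteq> y" by (auto simp: interval_def)
  from po have "trans r" "antisym r" "(y, y) \<in> r"
    using xy by (auto simp: partial_order_on_def preorder_on_def refl_on_def Field_def)
  then have "interval r x z \<subset> interval r x y"
    using zy xy by (auto simp: interval_def dest: transD antisymD)
  with fin show ?case by (simp add: psubset_card_mono)
qed auto

declare mobius.simps [simp del]

section \<open>Partitions and semistandard Young tableaux\<close>

definition is_partition :: "nat list \<Rightarrow> bool" where
  "is_partition lam \<longleftrightarrow> sorted_wrt (\<ge>) lam \<and> 0 \<notin> set lam"

text \<open>
  Cells are (row, column), counted from 0, in English notation: row 0 is the top row.
  A tableau is a filling of the cells that is 0 off the diagram, so that two tableaux of the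
  same shape are equal iff their entries agree.
\<close>

type_synonym cell = "nat \<times> nat"
type_synonym tableau = "cell \<Rightarrow> nat"

definition diagram :: "nat list \<Rightarrow> cell set" where
  "diagram lam = {(r, c). r < length lam \<and> c < lam ! r}"

definition ssyt :: "nat \<Rightarrow> nat list \<Rightarrow> tableau set" where
  "ssyt n lam =
     {T. (\<forall>x. x \<notin> diagram lam \<longrightarrow> T x = 0) \<and>
         (\<forall>x \<in> diagram lam. T x \<in> {1..n}) \<and>
         (\<forall>r c c'. c < c' \<and> (r, c) \<in> diagram lam \<and> (r, c') \<in> diagram lam
            \<longrightarrow> T (r, c) \<le> T (r, c')) \<and>
         (\<forall>r r' c. r < r' \<and> (r, c) \<in> diagram lam \<and> (r', c) \<in> diagram lam
            \<longrightarrow> T (r, c) < T (r', c))}"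

section \<open>Crystal operators by the signature rule\<close>

text \<open>Columns from left to right, each column from bottom to top.\<close>

definition reading_cells :: "nat list \<Rightarrow> cell list" where
  "reading_cells lam =
     concat (map (\<lambda>c. filter (\<lambda>x. x \<in> diagram lam) (map (\<lambda>r. (r, c)) (rev [0..<length lam])))
                 [0..<Max (set (0 # lam))])"

datatype sign = Plus | Minus

text \<open>Each sign remembers the cell it comes from.\<close>

definition signature :: "nat list \<Rightarrow> nat \<Rightarrow> tableau \<Rightarrow> (sign \<times> cell) list" where
  "signature lam i T =
     map (\<lambda>x. (if T x = i then Plus else Minus, x))
         (filter (\<lambda>x. T x = i \<or> T x = Suc i) (reading_cells lam))"

text \<open>
  A single cancellation of an adjacent pair \<open>-+\<close>, and a function computing the result of
  cancelling as long as possible; \<open>cancel_eq_iff\<close> below relates the two.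
\<close>

inductive cancel_step :: "(sign \<times> 'c) list \<Rightarrow> (sign \<times> 'c) list \<Rightarrow> bool" where
  "cancel_step (us @ (Minus, a) # (Plus, b) # vs) (us @ vs)"

fun cancel_cons :: "sign \<times> 'c \<Rightarrow> (sign \<times> 'c) list \<Rightarrow> (sign \<times> 'c) list" where
  "cancel_cons (Minus, a) ((Plus, b) # w) = w"
| "cancel_cons p w = p # w"

definition cancel :: "(sign \<times> 'c) list \<Rightarrow> (sign \<times> 'c) list" where
  "cancel w = foldr cancel_cons w []"

lemma cancel_step_Cons: "cancel_step v w \<Longrightarrow> cancel_step (p # v) (p # w)"
  by (metis append_Cons cancel_step.simps)

lemma cancel_steps_Cons: "cancel_step\<^sup>*\<^sup>* v w \<Longrightarrow> cancel_step\<^sup>*\<^sup>* (p # v) (p # w)"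
  by (induction rule: rtranclp_induct) (auto intro: cancel_step_Cons rtranclp.rtrancl_into_rtrancl)

lemma cancel_cons_steps: "cancel_step\<^sup>*\<^sup>* (p # w) (cancel_cons p w)"
  by (cases "(p, w)" rule: cancel_cons.cases)
    (auto intro: r_into_rtranclp cancel_step.intros[of "[]", simplified])

lemma cancel_steps: "cancel_step\<^sup>*\<^sup>* w (cancel w)"
proof (induction w)
  case (Cons p w)
  have "cancel_step\<^sup>*\<^sup>* (p # w) (p # cancel w)"
    by (rule cancel_steps_Cons[OF Cons.IH])
  also have "cancel_step\<^sup>*\<^sup>* (p # cancel w) (cancel_cons p (cancel w))"
    by (rule cancel_cons_steps)
  finally show ?case by (simp add: cancel_def)
qed (simp add: cancel_def)

text \<open>The result has the form \<open>+^x -^y\<close>.\<close>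

lemma cancel_form:
  "\<exists>us vs. cancel w = map (Pair Plus) us @ map (Pair Minus) vs"
proof (induction w)
  case (Cons p w)
  then obtain us vs where w: "cancel w = map (Pair Plus) us @ map (Pair Minus) vs" by blast
  obtain s a where p: "p = (s, a)" by fastforce
  have c: "cancel (p # w) = cancel_cons p (cancel w)" by (simp add: cancel_def)
  show ?case
  proof (cases s)
    case Plus
    then have "cancel (p # w) = map (Pair Plus) (a # us) @ map (Pair Minus) vs"
      using c w p by simp
    then show ?thesis by blast
  next
    case Minus
    show ?thesis
    proof (cases us)
      case Nil
      then have "cancel (p # w) = map (Pair Plus) [] @ map (Pair Minus) (a # vs)"
        using c w p Minus by (cases vs) auto
      then show ?thesis by blast
    next
      case (Cons u us')
      then have "cancel (p # w) = map (Pair Plus) us' @ map (Pair Minus) vs"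
        using c w p Minus by simp
      then show ?thesis by blast
    qed
  qed
qed (auto simp: cancel_def)

lemma cancel_step_invariant: "cancel_step v w \<Longrightarrow> cancel v = cancel w"
proof (induction rule: cancel_step.induct)
  case (1 us a b vs)
  obtain xs ys where "cancel vs = map (Pair Plus) xs @ map (Pair Minus) ys"
    using cancel_form by blast
  then show ?case by (simp add: cancel_def)
qed

lemma cancel_fixed:
  assumes "\<nexists>v. cancel_step w v"
  shows "cancel w = w"
  using cancel_steps[of w] assms by (metis converse_rtranclpE)

lemma cancel_irreducible: "\<not> cancel_step (cancel w) v"
proof
  assume "cancel_step (cancel w) v"
  then obtain us a b vs where e: "cancel w = us @ (Minus, a) # (Plus, b) # vs"
    by (auto elim: cancel_step.cases)
  obtain xs ys where "cancel w = map (Pair Plus) xs @ map (Pair Minus) ys"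
    using cancel_form by blast
  with e show False
    by (auto simp: append_eq_append_conv2 append_eq_Cons_conv Cons_eq_append_conv map_eq_append_conv
        map_eq_Cons_conv)
qed

lemma cancel_eq_iff:
  "cancel w = v \<longleftrightarrow> cancel_step\<^sup>*\<^sup>* w v \<and> (\<nexists>v'. cancel_step v v')"
proof
  assume "cancel_step\<^sup>*\<^sup>* w v \<and> (\<nexists>v'. cancel_step v v')"
  moreover have "cancel w = cancel v" if "cancel_step\<^sup>*\<^sup>* w v"
    using that by induction (auto dest: cancel_step_invariant)
  ultimately show "cancel w = v" using cancel_fixed by metis
qed (use cancel_steps cancel_irreducible in auto)

text \<open>\<open>None\<close> stands for the element \<open>0\<close> outside the crystal.\<close>

definition crystal_f :: "nat list \<Rightarrow> nat \<Rightarrow> tableau \<Rightarrow> tableau option" where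
  "crystal_f lam i T =
     (let ps = [x. (s, x) \<leftarrow> cancel (signature lam i T), s = Plus]
      in if ps = [] then None else Some (T(last ps := Suc i)))"

section \<open>The crystal poset of type A\<close>

definition crystal_step :: "nat \<Rightarrow> nat list \<Rightarrow> tableau rel" where
  "crystal_step n lam =
     {(S, T). S \<in> ssyt n lam \<and> (\<exists>i \<in> {1..<n}. crystal_f lam i S = Some T)}"

definition crystal_order :: "nat \<Rightarrow> nat list \<Rightarrow> tableau rel" where
  "crystal_order n lam = Restr ((crystal_step n lam)\<^sup>*) (ssyt n lam)"

text \<open>
  The crystal order is a finite partial order with carrier \<open>ssyt n lam\<close>, so that the guards
  in the definition of \<open>mobius\<close> are always met.
\<close>

lemma finite_diagram: "finite (diagram lam)"
proof -
  have "diagram lam = Sigma {..<length lam} (\<lambda>r. {..<lam ! r})"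
    by (auto simp: diagram_def)
  then show ?thesis by simp
qed

lemma finite_ssyt: "finite (ssyt n lam)"
proof (rule finite_subset)
  show "ssyt n lam \<subseteq> {T. \<forall>x. (x \<in> diagram lam \<longrightarrow> T x \<in> {1..n}) \<and> (x \<notin> diagram lam \<longrightarrow> T x = 0)}"
    by (auto simp: ssyt_def)
  show "finite \<dots>"
    by (rule finite_set_of_finite_funs) (auto simp: finite_diagram)
qed

lemma cancel_subset: "set (cancel w) \<subseteq> set w"
proof -
  have step: "set v' \<subseteq> set v" if "cancel_step v v'" for v v' :: "(sign \<times> 'a) list"
    using that by cases auto
  have "set v' \<subseteq> set v" if "cancel_step\<^sup>*\<^sup>* v v'" for v v' :: "(sign \<times> 'a) list"
    using that by (induction rule: rtranclp_induct) (use step in blast)+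
  then show ?thesis using cancel_steps by blast
qed

lemma crystal_f_SomeE:
  assumes "crystal_f lam i S = Some T"
  obtains x where "x \<in> diagram lam" "S x = i" "T = S(x := Suc i)"
proof -
  define ps where "ps = [x. (s, x) \<leftarrow> cancel (signature lam i S), s = Plus]"
  have ne: "ps \<noteq> []" and T: "T = S(last ps := Suc i)"
    using assms by (auto simp: crystal_f_def ps_def Let_def split: if_splits)
  have "(Plus, last ps) \<in> set (cancel (signature lam i S))"
    using last_in_set[OF ne] by (auto simp: ps_def split: if_splits)
  then have "(Plus, last ps) \<in> set (signature lam i S)"
    using cancel_subset by blast
  then have "last ps \<in> diagram lam" "S (last ps) = i"
    by (auto simp: signature_def reading_cells_def split: if_splits)
  with T that show thesis by blast
qed

lemma crystal_step_sum:
  assumes "(S, T) \<in> crystal_step n lam"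
  shows "sum S (diagram lam) < sum T (diagram lam)"
proof -
  obtain i where "crystal_f lam i S = Some T"
    using assms by (auto simp: crystal_step_def)
  then obtain x where "x \<in> diagram lam" "S x = i" "T = S(x := Suc i)"
    by (rule crystal_f_SomeE)
  then show ?thesis
    by (intro sum_strict_mono_ex1 finite_diagram) auto
qed

lemma crystal_steps_sum:
  assumes "(S, T) \<in> (crystal_step n lam)\<^sup>*"
  shows "S = T \<or> sum S (diagram lam) < sum T (diagram lam)"
  using assms by induction (auto dest: crystal_step_sum)

lemma Field_crystal_order: "Field (crystal_order n lam) = ssyt n lam"
  by (auto simp: crystal_order_def Field_def)

lemma Partial_order_crystal_order: "Partial_order (crystal_order n lam)"
  unfolding Field_crystal_order partial_order_on_def preorder_on_def
proof (intro conjI)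
  show "refl_on (ssyt n lam) (crystal_order n lam)"
    by (auto simp: refl_on_def crystal_order_def)
  show "trans (crystal_order n lam)"
    by (auto simp: crystal_order_def intro!: transI)
  show "antisym (crystal_order n lam)"
    by (rule antisymI) (auto simp: crystal_order_def dest!: crystal_steps_sum)
qed (auto simp: crystal_order_def)

lemma finite_interval_crystal_order: "finite (interval (crystal_order n lam) u v)"
  by (rule finite_subset[OF _ finite_ssyt[of n lam]]) (auto simp: interval_def crystal_order_def)

end

theory Submission
  imports Defs
begin

text \<open>
  In the crystal of shape (3,3) with entries up to 4, the open interval between 112/234 and 123/344
  has three connected components, and its Moebius function is 2. Tableaux of rectangular shapes of
  the same width can be stacked, the letters of the lower one being shifted beyond those of the
  upper one. As long as no letter crosses from the upper alphabet to the lower one, the two parts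
  evolve independently, so intervals between stacked tableaux are products and Moebius functions
  multiply. Stacking copies of the interval above yields all powers of 2.
\<close>

section \<open>Products of intervals\<close>

lemma interval_subset: "trans r \<Longrightarrow> (z, y) \<in> r \<Longrightarrow> interval r x z \<subseteq> interval r x y"
  by (auto simp: interval_def dest: transD)

lemma interval_psubset:
  assumes "Partial_order r" "(x, y) \<in> r" "(z, y) \<in> r" "z \<noteq> y"
  shows "interval r x z \<subset> interval r x y"
proof -
  from assms have "trans r" "antisym r" "(y, y) \<in> r"
    by (auto simp: partial_order_on_def preorder_on_def refl_on_def Field_def)
  then show ?thesis
    using assms by (auto simp: interval_def dest: transD antisymD)
qed

lemma interval_self:
  assumes "Partial_order r" "(x, x) \<in> r"
  shows "interval r x x = {x}"
  using assms by (auto simp: interval_def partial_order_on_def dest: antisymD)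

text \<open>The defining recursion with the top term moved to the other side; in this form the
  identities of two posets can be multiplied.\<close>

lemma sum_mobius_interval:
  assumes po: "Partial_order r" and fin: "finite (interval r x y)" and xy: "(x, y) \<in> r"
  shows "(\<Sum>z\<in>interval r x y. mobius r x z) = (if x = y then 1 else 0)"
proof (cases "x = y")
  case True
  then have "mobius r x x = 1"
    using assms by (subst mobius.simps) simp
  then show ?thesis
    using True interval_self[OF po, of x] xy by simp
next
  case False
  have "y \<in> interval r x y"
    using po xy
    by (auto simp: interval_def partial_order_on_def preorder_on_def refl_on_def Field_def)
  moreover have "mobius r x y = - (\<Sum>z\<in>interval r x y - {y}. mobius r x z)"
    using assms False by (subst mobius.simps) simp
  ultimately show ?thesis
    using False fin by (simp add: sum.remove)
qed

text \<open>The product of the two Moebius functions obeys the recursion that determines the Moebius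
  function of \<open>r\<close> on the image. The induction adds the sizes of both intervals, so that
  shrinking either factor counts as progress.\<close>

lemma mobius_product:
  assumes po1: "Partial_order r1" and po2: "Partial_order r2" and po: "Partial_order r"
    and fin1: "\<And>y. finite (interval r1 x1 y)" and fin2: "\<And>y. finite (interval r2 x2 y)"
    and inj: "inj_on (case_prod \<phi>) (Field r1 \<times> Field r2)"
    and le: "\<And>z1 z2. (x1, z1) \<in> r1 \<Longrightarrow> (x2, z2) \<in> r2 \<Longrightarrow> (\<phi> x1 x2, \<phi> z1 z2) \<in> r"
    and interval: "\<And>z1 z2. (x1, z1) \<in> r1 \<Longrightarrow> (x2, z2) \<in> r2 \<Longrightarrow>
      interval r (\<phi> x1 x2) (\<phi> z1 z2) = case_prod \<phi> ` (interval r1 x1 z1 \<times> interval r2 x2 z2)"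
    and "(x1, y1) \<in> r1" "(x2, y2) \<in> r2"
  shows "mobius r (\<phi> x1 x2) (\<phi> y1 y2) = mobius r1 x1 y1 * mobius r2 x2 y2"
  using assms(9,10)
proof (induction "card (interval r1 x1 y1) + card (interval r2 x2 y2)" arbitrary: y1 y2
    rule: less_induct)
  case less
  let ?I1 = "interval r1 x1 y1" and ?I2 = "interval r2 x2 y2" and ?f = "case_prod \<phi>"
  let ?m = "\<lambda>p. mobius r1 x1 (fst p) * mobius r2 x2 (snd p)"
  have y: "y1 \<in> ?I1" "y2 \<in> ?I2"
    using po1 po2 less.prems
    by (auto simp: interval_def partial_order_on_def preorder_on_def refl_on_def Field_def)
  have I_Field: "?I1 \<times> ?I2 \<subseteq> Field r1 \<times> Field r2"
    by (auto simp: interval_def Field_def)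
  have int: "interval r (\<phi> x1 x2) (\<phi> y1 y2) = ?f ` (?I1 \<times> ?I2)"
    by (rule interval[OF less.prems])
  then have fin: "finite (interval r (\<phi> x1 x2) (\<phi> y1 y2))"
    using fin1 fin2 by simp
  \<comment> \<open>The sum over the product set factors into the two one-factor sums, each of which
    is 0 or 1.\<close>
  have total: "(\<Sum>p\<in>?I1 \<times> ?I2. ?m p) = (if x1 = y1 \<and> x2 = y2 then 1 else 0)"
    using sum_mobius_interval[OF po1 fin1 less.prems(1)] sum_mobius_interval[OF po2 fin2 less.prems(2)]
    by (simp add: sum.cartesian_product' flip: sum_product)
  have "x1 \<in> Field r1" "x2 \<in> Field r2" "y1 \<in> Field r1" "y2 \<in> Field r2"
    using less.prems by (auto simp: Field_def)
  then have eq: "\<phi> x1 x2 = \<phi> y1 y2 \<longleftrightarrow> x1 = y1 \<and> x2 = y2"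
    using inj_onD[OF inj, of "(x1, x2)" "(y1, y2)"] by auto
  show ?case
  proof (cases "x1 = y1 \<and> x2 = y2")
    case True
    then have "mobius r1 x1 y1 = 1" "mobius r2 x2 y2 = 1"
      using po1 po2 fin1 fin2 less.prems by (subst mobius.simps; simp)+
    moreover have "mobius r (\<phi> x1 x2) (\<phi> y1 y2) = 1"
      using True fin po le[OF less.prems] by (subst mobius.simps) simp
    ultimately show ?thesis by simp
  next
    case False
    have inj': "inj_on ?f (?I1 \<times> ?I2)"
      using inj I_Field by (rule inj_on_subset)
    have rest: "interval r (\<phi> x1 x2) (\<phi> y1 y2) - {\<phi> y1 y2} = ?f ` (?I1 \<times> ?I2 - {(y1, y2)})"
      using inj_on_image_set_diff[OF inj', of "?I1 \<times> ?I2" "{(y1, y2)}"] y int by auto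
    have IH: "mobius r (\<phi> x1 x2) (?f p) = ?m p" if p: "p \<in> ?I1 \<times> ?I2 - {(y1, y2)}" for p
    proof -
      obtain z1 z2 where z: "p = (z1, z2)" by fastforce
      then have le1: "(x1, z1) \<in> r1" "(z1, y1) \<in> r1" and le2: "(x2, z2) \<in> r2" "(z2, y2) \<in> r2"
        and ne: "z1 \<noteq> y1 \<or> z2 \<noteq> y2"
        using p by (auto simp: interval_def)
      have "interval r1 x1 z1 \<subseteq> ?I1" "interval r2 x2 z2 \<subseteq> ?I2"
        using le1 le2 po1 po2
        by (simp_all add: partial_order_on_def preorder_on_def interval_subset)
      \<comment> \<open>The pair differs from the top in some coordinate, and that factor shrinks
        strictly.\<close>
      moreover have "interval r1 x1 z1 \<subset> ?I1 \<or> interval r2 x2 z2 \<subset> ?I2"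
        using ne interval_psubset[OF po1 less.prems(1) le1(2)]
          interval_psubset[OF po2 less.prems(2) le2(2)] by blast
      ultimately have "card (interval r1 x1 z1) + card (interval r2 x2 z2) < card ?I1 + card ?I2"
        using fin1[of y1] fin2[of y2] card_mono[of ?I1 "interval r1 x1 z1"]
          card_mono[of ?I2 "interval r2 x2 z2"] psubset_card_mono[of ?I1 "interval r1 x1 z1"]
          psubset_card_mono[of ?I2 "interval r2 x2 z2"]
        by linarith
      from less.hyps[OF this le1(1) le2(1)] show ?thesis
        using z by simp
    qed
    have "mobius r (\<phi> x1 x2) (\<phi> y1 y2)
        = - (\<Sum>z\<in>interval r (\<phi> x1 x2) (\<phi> y1 y2) - {\<phi> y1 y2}. mobius r (\<phi> x1 x2) z)"
      using False eq po fin le[OF less.prems] by (subst mobius.simps) (simp only: if_True if_False simp_thms)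
    also have "\<dots> = - (\<Sum>p\<in>?I1 \<times> ?I2 - {(y1, y2)}. ?m p)"
      unfolding rest using IH inj_on_subset[OF inj', of "?I1 \<times> ?I2 - {(y1, y2)}"]
      by (subst sum.reindex) (auto simp: o_def intro!: sum.cong)
    \<comment> \<open>\<open>total\<close> is 0 in this case, so the terms other than the top one
      add up to the negative of the top one.\<close>
    also have "\<dots> = ?m (y1, y2)"
      using total False fin1 fin2 y by (simp add: sum.remove[of _ "(y1, y2)"])
    finally show ?thesis by simp
  qed
qed

section \<open>Stacking rectangular tableaux\<close>

lemma diagram_rect: "diagram (replicate m w) = {..<m} \<times> {..<w}"
  by (auto simp: diagram_def)

lemma reading_cells_rect:
  "reading_cells (replicate m w) = concat (map (\<lambda>c. map (\<lambda>r. (r, c)) (rev [0..<m])) [0..<w])"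
\<comment> \<open>Without rows the maximum in \<open>reading_cells\<close> is 0 instead of
  \<open>w\<close>, but both sides are then empty.\<close>
proof (cases "m = 0")
  case False
  then have "Max (set (0 # replicate m w)) = w" by simp
  then show ?thesis
    by (auto simp: reading_cells_def diagram_rect intro!: arg_cong[of _ _ concat])
qed (simp add: reading_cells_def)

lemma filter_reading_cells_top:
  assumes "\<And>r c. m1 \<le> r \<Longrightarrow> \<not> P (r, c)"
  shows "filter P (reading_cells (replicate (m1 + m2) w)) = filter P (reading_cells (replicate m1 w))"
  using assms
  by (auto simp: reading_cells_rect filter_concat upt_add_eq_append[of 0] comp_def filter_empty_conv
      intro!: arg_cong[of _ _ concat])

text \<open>In each column the lower \<open>m2\<close> rows form a contiguous block, which is the
  column of the smaller rectangle moved down by \<open>m1\<close>.\<close>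

lemma filter_reading_cells_bottom:
  assumes "\<And>r c. r < m1 \<Longrightarrow> \<not> P (r, c)"
  shows "filter P (reading_cells (replicate (m1 + m2) w)) =
    map (map_prod ((+) m1) id) (filter (P \<circ> map_prod ((+) m1) id) (reading_cells (replicate m2 w)))"
proof -
  have "[m1..<m1 + m2] = map ((+) m1) [0..<m2]"
    by (induction m2) auto
  then show ?thesis
    using assms
    by (auto simp: reading_cells_rect filter_concat upt_add_eq_append[of 0] comp_def filter_empty_conv
        map_concat filter_map rev_map intro!: arg_cong[of _ _ concat])
qed

text \<open>Cancellation looks at signs only, so relabelling the cells commutes with it.\<close>

lemma cancel_map: "cancel (map (apsnd g) w) = map (apsnd g) (cancel w)"
proof (induction w)
  case (Cons p w)
  have "cancel_cons (apsnd g p) (map (apsnd g) v) = map (apsnd g) (cancel_cons p v)"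
    for v
    by (cases "(p, v)" rule: cancel_cons.cases) auto
  with Cons show ?case by (simp add: cancel_def del: id_apply)
qed (simp add: cancel_def)

text \<open>The guard keeps the cells off the diagram 0.\<close>

definition stack :: "nat \<Rightarrow> nat \<Rightarrow> tableau \<Rightarrow> tableau \<Rightarrow> tableau" where
  "stack m n S T = (\<lambda>(r, c). if r < m then S (r, c) else if T (r - m, c) = 0 then 0 else n + T (r - m, c))"

section \<open>Stacked semistandard tableaux\<close>

lemma ssyt_rect_iff:
  "T \<in> ssyt n (replicate m w) \<longleftrightarrow>
     (\<forall>r c. (m \<le> r \<or> w \<le> c) \<longrightarrow> T (r, c) = 0) \<and>
     (\<forall>r<m. \<forall>c<w. 1 \<le> T (r, c) \<and> T (r, c) \<le> n) \<and>
     (\<forall>r<m. \<forall>c'<w. \<forall>c<c'. T (r, c) \<le> T (r, c')) \<and>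
     (\<forall>r'<m. \<forall>r<r'. \<forall>c<w. T (r, c) < T (r', c))"
  unfolding ssyt_def diagram_rect
  by (auto simp: not_less)

lemma stack_ssyt:
  assumes "S \<in> ssyt n1 (replicate m1 w)" "T \<in> ssyt n2 (replicate m2 w)"
  shows "stack m1 n1 S T \<in> ssyt (n1 + n2) (replicate (m1 + m2) w)"
proof -
  have T: "1 \<le> T (r - m1, c)" "T (r - m1, c) \<le> n2" if "m1 \<le> r" "r < m1 + m2" "c < w" for r c
    using assms(2) that unfolding ssyt_rect_iff by auto
  have "stack m1 n1 S T (r, c) = 0" if "m1 + m2 \<le> r \<or> w \<le> c" for r c
    using assms that unfolding ssyt_rect_iff by (auto simp: stack_def)
  moreover have "1 \<le> stack m1 n1 S T (r, c) \<and> stack m1 n1 S T (r, c) \<le> n1 + n2"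
    if "r < m1 + m2" "c < w" for r c
    using assms(1) T[of r c] that unfolding ssyt_rect_iff by (auto simp: stack_def not_less trans_le_add1)
  moreover have "stack m1 n1 S T (r, c) \<le> stack m1 n1 S T (r, c')"
    if "r < m1 + m2" "c' < w" "c < c'" for r c c'
  proof -
    have "T (r - m1, c) \<le> T (r - m1, c')" if "m1 \<le> r"
      using assms(2) \<open>r < m1 + m2\<close> \<open>c' < w\<close> \<open>c < c'\<close> that unfolding ssyt_rect_iff by auto
    then show ?thesis
      using assms(1) that unfolding ssyt_rect_iff by (auto simp: stack_def not_less)
  qed
  moreover have "stack m1 n1 S T (r, c) < stack m1 n1 S T (r', c)"
    if "r' < m1 + m2" "r < r'" "c < w" for r r' c
  \<comment> \<open>The one comparison that mixes the two parts: the upper entry is at most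
    \<open>n1\<close>, the lower one at least \<open>n1 + 1\<close>.\<close>
  proof (cases "r < m1 \<and> m1 \<le> r'")
    case True
    then have "S (r, c) \<le> n1"
      using assms(1) that unfolding ssyt_rect_iff by auto
    then show ?thesis
      using True T[of r' c] that by (auto simp: stack_def)
  next
    case False
    have "T (r - m1, c) < T (r' - m1, c)" if "m1 \<le> r"
      using assms(2) \<open>r' < m1 + m2\<close> \<open>r < r'\<close> \<open>c < w\<close> that unfolding ssyt_rect_iff by auto
    then show ?thesis
      using assms(1) False that unfolding ssyt_rect_iff by (auto simp: stack_def not_less)
  qed
  ultimately show ?thesis
    unfolding ssyt_rect_iff by blast
qed

text \<open>\<open>stack\<close> does not see \<open>S\<close> from row \<open>m1\<close> on, but
  membership in \<open>ssyt\<close> makes it 0 there. The lower tableau can be recovered because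
  only the entry 0 is sent to 0.\<close>

lemma stack_inject:
  assumes "S \<in> ssyt n1 (replicate m1 w)" "S' \<in> ssyt n1 (replicate m1 w)"
    and eq: "stack m1 n S T = stack m1 n S' T'"
  shows "S = S' \<and> T = T'"
proof (intro conjI ext)
  fix x :: cell
  show "S x = S' x"
    using assms(1,2) fun_cong[OF eq, of x] unfolding ssyt_rect_iff
    by (cases x) (auto simp: stack_def split: if_splits)
  show "T x = T' x"
    using fun_cong[OF eq, of "(fst x + m1, snd x)"] by (auto simp: stack_def split: if_splits)
qed

section \<open>The signature rule on stacked tableaux\<close>

definition plus_cells :: "nat list \<Rightarrow> nat \<Rightarrow> tableau \<Rightarrow> cell list" where
  "plus_cells lam i T = [x. (s, x) \<leftarrow> cancel (signature lam i T), s = Plus]"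

lemma crystal_f_plus_cells:
  "crystal_f lam i T =
     (if plus_cells lam i T = [] then None else Some (T(last (plus_cells lam i T) := Suc i)))"
  by (simp add: crystal_f_def plus_cells_def Let_def)

lemma plus_cells_subset: "set (plus_cells lam i T) \<subseteq> diagram lam"
proof
  fix x assume "x \<in> set (plus_cells lam i T)"
  then have "(Plus, x) \<in> set (cancel (signature lam i T))"
    by (auto simp: plus_cells_def split: if_splits)
  then have "(Plus, x) \<in> set (signature lam i T)"
    using cancel_subset by blast
  then show "x \<in> diagram lam"
    by (auto simp: signature_def reading_cells_def)
qed

text \<open>The letters \<open>i\<close> and \<open>Suc i\<close> are positive and at most
  \<open>n1\<close>, whereas lower entries are 0 or exceed \<open>n1\<close>. Hence the stack and
  \<open>S\<close> have the same signature.\<close>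

lemma crystal_f_stack_top:
  assumes "1 \<le> i" "i < n1"
  shows "crystal_f (replicate (m1 + m2) w) i (stack m1 n1 S T) =
    map_option (\<lambda>S'. stack m1 n1 S' T) (crystal_f (replicate m1 w) i S)"
proof -
  have "filter (\<lambda>x. stack m1 n1 S T x = i \<or> stack m1 n1 S T x = Suc i)
      (reading_cells (replicate (m1 + m2) w))
    = filter (\<lambda>x. stack m1 n1 S T x = i \<or> stack m1 n1 S T x = Suc i) (reading_cells (replicate m1 w))"
    using assms by (intro filter_reading_cells_top) (auto simp: stack_def)
  also have "\<dots> = filter (\<lambda>x. S x = i \<or> S x = Suc i) (reading_cells (replicate m1 w))"
    by (rule filter_cong) (auto simp: stack_def reading_cells_rect)
  finally have "signature (replicate (m1 + m2) w) i (stack m1 n1 S T) = signature (replicate m1 w) i S"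
    by (auto simp: signature_def stack_def reading_cells_rect)
  then have plus: "plus_cells (replicate (m1 + m2) w) i (stack m1 n1 S T) = plus_cells (replicate m1 w) i S"
    by (simp add: plus_cells_def)
  show ?thesis
  proof (cases "plus_cells (replicate m1 w) i S = []")
    case False
    \<comment> \<open>The changed cell lies in the upper rows, so updating it commutes with
      stacking.\<close>
    then have "last (plus_cells (replicate m1 w) i S) \<in> {..<m1} \<times> {..<w}"
      using plus_cells_subset last_in_set unfolding diagram_rect[symmetric] by blast
    then show ?thesis
      using False plus by (auto simp: crystal_f_plus_cells stack_def fun_eq_iff)
  qed (simp add: plus crystal_f_plus_cells)
qed

text \<open>All entries of \<open>S\<close> are below \<open>n1 + i\<close>, so the signature is
  that of \<open>T\<close> with its cells moved down by \<open>m1\<close> rows.\<close>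

lemma crystal_f_stack_bottom:
  assumes "1 \<le> i" and S: "S \<in> ssyt n1 (replicate m1 w)"
  shows "crystal_f (replicate (m1 + m2) w) (n1 + i) (stack m1 n1 S T) =
    map_option (stack m1 n1 S) (crystal_f (replicate m2 w) i T)"
proof -
  define g :: "cell \<Rightarrow> cell" where "g = map_prod ((+) m1) id"
  define P where "P = (\<lambda>x. stack m1 n1 S T x = n1 + i \<or> stack m1 n1 S T x = Suc (n1 + i))"
  have Sle: "S (r, c) < n1 + i" if "r < m1" for r c
  proof -
    have "S (r, c) \<le> n1"
      using S that unfolding ssyt_rect_iff by (cases "c < w") auto
    then show ?thesis
      using \<open>1 \<le> i\<close> by simp
  qed
  have g: "stack m1 n1 S T (g x) = (if T x = 0 then 0 else n1 + T x)" for x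
    by (cases x) (simp add: stack_def g_def)
  have "filter P (reading_cells (replicate (m1 + m2) w)) = map g (filter (P \<circ> g) (reading_cells (replicate m2 w)))"
    unfolding g_def
  proof (rule filter_reading_cells_bottom)
    show "\<not> P (r, c)" if "r < m1" for r c
      using Sle[of r c] that by (auto simp: P_def stack_def)
  qed
  \<comment> \<open>Since \<open>i\<close> is positive, the zeros of \<open>T\<close> are rejected
    on both sides.\<close>
  also have "P \<circ> g = (\<lambda>x. T x = i \<or> T x = Suc i)"
    using assms(1) by (auto simp: P_def g fun_eq_iff)
  finally have "signature (replicate (m1 + m2) w) (n1 + i) (stack m1 n1 S T)
      = map (apsnd g) (signature (replicate m2 w) i T)"
    using assms(1) by (auto simp: signature_def P_def g)
  then have plus: "plus_cells (replicate (m1 + m2) w) (n1 + i) (stack m1 n1 S T) = map g (plus_cells (replicate m2 w) i T)"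
    by (auto simp: plus_cells_def cancel_map map_concat comp_def intro!: arg_cong[of _ _ concat])
  show ?thesis
  proof (cases "plus_cells (replicate m2 w) i T = []")
    case False
    obtain r c where rc: "last (plus_cells (replicate m2 w) i T) = (r, c)" by fastforce
    have "(stack m1 n1 S T)(g (r, c) := Suc (n1 + i)) = stack m1 n1 S (T((r, c) := Suc i))"
      by (auto simp: stack_def g_def fun_eq_iff)
    then show ?thesis
      using False plus rc by (simp add: crystal_f_plus_cells last_map)
  qed (simp add: plus crystal_f_plus_cells)
qed

section \<open>The crystal order on stacked tableaux\<close>

lemma crystal_steps_mono: "(S, T) \<in> (crystal_step n lam)\<^sup>* \<Longrightarrow> S x \<le> T x"
proof (induction rule: rtrancl_induct)
  case (step T T')
  then obtain i where "crystal_f lam i T = Some T'"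
    by (auto simp: crystal_step_def)
  then have "T x \<le> T' x"
    by (rule crystal_f_SomeE) auto
  with step show ?case by simp
qed simp

lemma crystal_step_stack_top:
  assumes "(S, S') \<in> crystal_step n1 (replicate m1 w)" "T \<in> ssyt n2 (replicate m2 w)"
  shows "(stack m1 n1 S T, stack m1 n1 S' T) \<in> crystal_step (n1 + n2) (replicate (m1 + m2) w)"
proof -
  obtain i where i: "i \<in> {1..<n1}" "crystal_f (replicate m1 w) i S = Some S'" "S \<in> ssyt n1 (replicate m1 w)"
    using assms(1) by (auto simp: crystal_step_def)
  then have "crystal_f (replicate (m1 + m2) w) i (stack m1 n1 S T) = Some (stack m1 n1 S' T)"
    by (simp add: crystal_f_stack_top)
  moreover have "i \<in> {1..<n1 + n2}"
    using i by auto
  ultimately show ?thesis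
    using stack_ssyt[OF i(3) assms(2)] unfolding crystal_step_def by blast
qed

lemma crystal_step_stack_bottom:
  assumes "(T, T') \<in> crystal_step n2 (replicate m2 w)" "S \<in> ssyt n1 (replicate m1 w)"
  shows "(stack m1 n1 S T, stack m1 n1 S T') \<in> crystal_step (n1 + n2) (replicate (m1 + m2) w)"
proof -
  obtain i where i: "i \<in> {1..<n2}" "crystal_f (replicate m2 w) i T = Some T'" "T \<in> ssyt n2 (replicate m2 w)"
    using assms(1) by (auto simp: crystal_step_def)
  then have "crystal_f (replicate (m1 + m2) w) (n1 + i) (stack m1 n1 S T) = Some (stack m1 n1 S T')"
    using assms(2) by (simp add: crystal_f_stack_bottom)
  moreover have "n1 + i \<in> {1..<n1 + n2}"
    using i by auto
  ultimately show ?thesis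
    using stack_ssyt[OF assms(2) i(3)] unfolding crystal_step_def by blast
qed

text \<open>
  A step with \<open>i = n1\<close> would push an entry of the upper tableau beyond \<open>n1\<close>; hence the two
  tableaux evolve independently.
\<close>

lemma crystal_step_stackD:
  assumes "S \<in> ssyt n1 (replicate m1 w)" "T \<in> ssyt n2 (replicate m2 w)"
    and "S' \<in> ssyt n1 (replicate m1 w)"
    and step: "(stack m1 n1 S T, stack m1 n1 S' T') \<in> crystal_step (n1 + n2) (replicate (m1 + m2) w)"
  shows "(S, S') \<in> crystal_step n1 (replicate m1 w) \<and> T = T' \<or>
    S = S' \<and> (T, T') \<in> crystal_step n2 (replicate m2 w)"
proof -
  obtain i where i: "1 \<le> i" "i < n1 + n2"
    and f: "crystal_f (replicate (m1 + m2) w) i (stack m1 n1 S T) = Some (stack m1 n1 S' T')"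
    using step by (auto simp: crystal_step_def)
  consider "i < n1" | "i = n1" | k where "i = n1 + k" "1 \<le> k"
    using that(3)[of "i - n1"] by fastforce
  then show ?thesis
  proof cases
    case 1
    then obtain S0 where S0: "crystal_f (replicate m1 w) i S = Some S0"
      "stack m1 n1 S0 T = stack m1 n1 S' T'"
      using f i by (auto simp: crystal_f_stack_top)
    \<comment> \<open>\<open>S0\<close> is not yet known to be semistandard. Below row
      \<open>m1\<close> it is 0 because it differs from \<open>S\<close> in a single cell of the
      diagram.\<close>
    have "S0 x = S' x" for x
    proof (cases "fst x < m1")
      case True
      then show ?thesis
        using fun_cong[OF S0(2), of x] by (auto simp: stack_def split: prod.splits)
    next
      case False
      obtain y where "y \<in> diagram (replicate m1 w)" "S0 = S(y := Suc i)"
        using S0(1) by (rule crystal_f_SomeE)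
      then show ?thesis
        using False assms(1,3) unfolding ssyt_rect_iff diagram_rect by (cases x) auto
    qed
    then have "S0 = S'" by blast
    moreover have "T = T'"
      using S0(2) stack_inject[OF assms(3) assms(3)] \<open>S0 = S'\<close> by blast
    ultimately show ?thesis
      using 1 i S0(1) assms(1) by (auto simp: crystal_step_def)
  next
    case 2
    obtain x where x: "stack m1 n1 S T x = n1" "stack m1 n1 S' T' = (stack m1 n1 S T)(x := Suc n1)"
      using f 2 by (elim crystal_f_SomeE) auto
    obtain r c where rc: "x = (r, c)" by fastforce
    \<comment> \<open>A lower entry is 0 or greater than \<open>n1\<close>, and \<open>n1\<close> is
      positive here, so the letter \<open>n1\<close> occurs in the upper part only.\<close>
    have "r < m1"
      using i 2 x(1) rc by (auto simp: stack_def split: if_splits)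
    then have "S' (r, c) = Suc n1"
      using fun_cong[OF x(2), of x] rc by (simp add: stack_def)
    moreover have "S' (r, c) \<le> n1"
      using assms(3) \<open>r < m1\<close> unfolding ssyt_rect_iff by (cases "c < w") auto
    ultimately show ?thesis by simp
  next
    case (3 k)
    then obtain T0 where T0: "crystal_f (replicate m2 w) k T = Some T0"
      "stack m1 n1 S T0 = stack m1 n1 S' T'"
      using f assms(1) by (auto simp: crystal_f_stack_bottom)
    then show ?thesis
      using 3 i assms(2) stack_inject[OF assms(1,3) T0(2)] by (auto simp: crystal_step_def)
  qed
qed

text \<open>The entrywise upper bound keeps the first \<open>m1\<close> rows of \<open>Z\<close>
  within \<open>n1\<close>, and the lower bound keeps the remaining rows above \<open>n1\<close>;
  thus \<open>Z\<close> can be cut and its lower part shifted back.\<close>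

lemma stack_between:
  assumes S: "S \<in> ssyt n1 (replicate m1 w)" "S' \<in> ssyt n1 (replicate m1 w)"
    and T: "T \<in> ssyt n2 (replicate m2 w)"
    and Z: "Z \<in> ssyt (n1 + n2) (replicate (m1 + m2) w)"
    and lower: "\<And>x. stack m1 n1 S T x \<le> Z x" and upper: "\<And>x. Z x \<le> stack m1 n1 S' T' x"
  obtains S0 T0 where "S0 \<in> ssyt n1 (replicate m1 w)" "T0 \<in> ssyt n2 (replicate m2 w)" "Z = stack m1 n1 S0 T0"
proof
  define S0 :: tableau where "S0 = (\<lambda>(r, c). if r < m1 then Z (r, c) else 0)"
  define T0 :: tableau where "T0 = (\<lambda>(r, c). Z (m1 + r, c) - n1)"
  have top: "Z (r, c) \<le> n1" if "r < m1" for r c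
  proof -
    have "S' (r, c) \<le> n1"
      using S(2) that unfolding ssyt_rect_iff by (cases "c < w") auto
    then show ?thesis
      using upper[of "(r, c)"] that by (simp add: stack_def)
  qed
  have bottom: "n1 < Z (m1 + r, c)" if "r < m2" "c < w" for r c
  proof -
    have "1 \<le> T (r, c)"
      using T that unfolding ssyt_rect_iff by blast
    then show ?thesis
      using lower[of "(m1 + r, c)"] by (simp add: stack_def)
  qed
  show "S0 \<in> ssyt n1 (replicate m1 w)"
    using Z top unfolding ssyt_rect_iff S0_def by auto
  have "T0 (r, c) = 0" if "m2 \<le> r \<or> w \<le> c" for r c
    using Z that unfolding ssyt_rect_iff T0_def by auto
  moreover have "1 \<le> T0 (r, c) \<and> T0 (r, c) \<le> n2" if "r < m2" "c < w" for r c
  proof -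
    have "Z (m1 + r, c) \<le> n1 + n2"
      using Z that unfolding ssyt_rect_iff by auto
    then show ?thesis
      using bottom[OF that] unfolding T0_def by auto
  qed
  moreover have "T0 (r, c) \<le> T0 (r, c')" if "r < m2" "c' < w" "c < c'" for r c c'
    using Z that unfolding ssyt_rect_iff T0_def by (auto intro: diff_le_mono)
  \<comment> \<open>Truncated subtraction preserves strictness here because the smaller entry
    exceeds \<open>n1\<close>.\<close>
  moreover have "T0 (r, c) < T0 (r', c)" if "r' < m2" "r < r'" "c < w" for r r' c
  proof -
    have "Z (m1 + r, c) < Z (m1 + r', c)"
      using Z that unfolding ssyt_rect_iff by auto
    then show ?thesis
      using bottom[of r c] that unfolding T0_def by auto
  qed
  ultimately show "T0 \<in> ssyt n2 (replicate m2 w)"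
    unfolding ssyt_rect_iff by blast
  have "Z (r, c) = stack m1 n1 S0 T0 (r, c)" for r c
  proof (cases "m1 \<le> r \<and> r < m1 + m2 \<and> c < w")
    case True
    then show ?thesis
      using bottom[of "r - m1" c] by (simp add: stack_def T0_def less_diff_conv2)
  next
    case False
    then show ?thesis
      using Z unfolding ssyt_rect_iff by (auto simp: stack_def S0_def T0_def)
  qed
  then show "Z = stack m1 n1 S0 T0" by auto
qed

text \<open>Along a chain the entries only grow, so every intermediate tableau lies entrywise
  between the two stacks and is itself a stack. Each step then moves exactly one of the two
  parts.\<close>

lemma crystal_order_stack_iff:
  assumes "S \<in> ssyt n1 (replicate m1 w)" "T \<in> ssyt n2 (replicate m2 w)"
    and S': "S' \<in> ssyt n1 (replicate m1 w)" and T': "T' \<in> ssyt n2 (replicate m2 w)"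
  shows "(stack m1 n1 S T, stack m1 n1 S' T') \<in> crystal_order (n1 + n2) (replicate (m1 + m2) w) \<longleftrightarrow>
    (S, S') \<in> crystal_order n1 (replicate m1 w) \<and> (T, T') \<in> crystal_order n2 (replicate m2 w)"
    (is "?L \<longleftrightarrow> ?R")
proof
  let ?E = "crystal_step (n1 + n2) (replicate (m1 + m2) w)"
  let ?E1 = "crystal_step n1 (replicate m1 w)" and ?E2 = "crystal_step n2 (replicate m2 w)"
  have "(S, S') \<in> ?E1\<^sup>* \<and> (T, T') \<in> ?E2\<^sup>*"
    if "(X, stack m1 n1 S' T') \<in> ?E\<^sup>*" "X = stack m1 n1 S T"
      "S \<in> ssyt n1 (replicate m1 w)" "T \<in> ssyt n2 (replicate m2 w)" for X S T
    using that
  proof (induction arbitrary: S T rule: converse_rtrancl_induct)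
    case base
    then show ?case
      using stack_inject[OF S' base(2)] by auto
  next
    case (step X Z)
    \<comment> \<open>Either \<open>Z\<close> is the upper endpoint, or it is the source of a
      further step, and sources are semistandard by definition.\<close>
    have Z: "Z \<in> ssyt (n1 + n2) (replicate (m1 + m2) w)"
      using step.hyps(2) stack_ssyt[OF S' T']
      by (cases rule: converse_rtranclE) (auto simp: crystal_step_def)
    have "stack m1 n1 S T x \<le> Z x" "Z x \<le> stack m1 n1 S' T' x" for x
      using step.hyps crystal_steps_mono r_into_rtrancl step.prems(1) by metis+
    then obtain S0 T0 where ST0: "S0 \<in> ssyt n1 (replicate m1 w)" "T0 \<in> ssyt n2 (replicate m2 w)"
      "Z = stack m1 n1 S0 T0"
      using stack_between[OF step.prems(2) S' step.prems(3) Z] by blast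
    have "(S0, S') \<in> ?E1\<^sup>* \<and> (T0, T') \<in> ?E2\<^sup>*"
      using step.IH[OF ST0(3,1,2)] .
    moreover have "(S, S0) \<in> ?E1 \<and> T = T0 \<or> S = S0 \<and> (T, T0) \<in> ?E2"
      using crystal_step_stackD[OF step.prems(2,3) ST0(1)] step.hyps(1) step.prems(1) ST0(3) by blast
    ultimately show ?case
      by (auto intro: converse_rtrancl_into_rtrancl)
  qed
  then show "?L \<Longrightarrow> ?R"
    using assms by (auto simp: crystal_order_def)
  assume ?R
  then have R: "(S, S') \<in> ?E1\<^sup>*" "(T, T') \<in> ?E2\<^sup>*"
    by (auto simp: crystal_order_def)
  \<comment> \<open>Conversely, the upper part is moved first and the lower part afterwards.\<close>
  from R(1) have "(stack m1 n1 S T, stack m1 n1 S' T) \<in> ?E\<^sup>*"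
    by induction (auto intro: rtrancl_into_rtrancl crystal_step_stack_top[OF _ assms(2)])
  also from R(2) have "(stack m1 n1 S' T, stack m1 n1 S' T') \<in> ?E\<^sup>*"
    by induction (auto intro: rtrancl_into_rtrancl crystal_step_stack_bottom[OF _ S'])
  finally show ?L
    using stack_ssyt assms by (auto simp: crystal_order_def)
qed

lemma mobius_stack:
  assumes "(S, S') \<in> crystal_order n1 (replicate m1 w)" "(T, T') \<in> crystal_order n2 (replicate m2 w)"
  shows "mobius (crystal_order (n1 + n2) (replicate (m1 + m2) w)) (stack m1 n1 S T) (stack m1 n1 S' T') =
    mobius (crystal_order n1 (replicate m1 w)) S S' * mobius (crystal_order n2 (replicate m2 w)) T T'"
proof (rule mobius_product[OF _ _ _ _ _ _ _ _ assms])
  let ?r = "crystal_order (n1 + n2) (replicate (m1 + m2) w)"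
  let ?r1 = "crystal_order n1 (replicate m1 w)" and ?r2 = "crystal_order n2 (replicate m2 w)"
  show "inj_on (\<lambda>(S, T). stack m1 n1 S T) (Field ?r1 \<times> Field ?r2)"
  proof (rule inj_onI, clarify)
    fix A B A' B' assume "A \<in> Field ?r1" "A' \<in> Field ?r1" "stack m1 n1 A B = stack m1 n1 A' B'"
    then show "A = A' \<and> B = B'"
      unfolding Field_crystal_order by (rule stack_inject)
  qed
  fix U V assume UV: "(S, U) \<in> ?r1" "(T, V) \<in> ?r2"
  then have ssyt: "S \<in> ssyt n1 (replicate m1 w)" "T \<in> ssyt n2 (replicate m2 w)"
    "U \<in> ssyt n1 (replicate m1 w)" "V \<in> ssyt n2 (replicate m2 w)"
    by (auto simp: crystal_order_def)
  show "(stack m1 n1 S T, stack m1 n1 U V) \<in> ?r"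
    using UV ssyt by (simp add: crystal_order_stack_iff)
  show "interval ?r (stack m1 n1 S T) (stack m1 n1 U V) =
    (\<lambda>(S, T). stack m1 n1 S T) ` (interval ?r1 S U \<times> interval ?r2 T V)" (is "?I = ?J")
  proof
    show "?I \<subseteq> ?J"
    proof
      fix Z assume "Z \<in> ?I"
      then have Z: "(stack m1 n1 S T, Z) \<in> ?r" "(Z, stack m1 n1 U V) \<in> ?r"
        by (auto simp: interval_def)
      then have "Z \<in> ssyt (n1 + n2) (replicate (m1 + m2) w)"
        "\<And>x. stack m1 n1 S T x \<le> Z x" "\<And>x. Z x \<le> stack m1 n1 U V x"
        by (auto simp: crystal_order_def crystal_steps_mono)
      then obtain S0 T0 where ST0: "S0 \<in> ssyt n1 (replicate m1 w)" "T0 \<in> ssyt n2 (replicate m2 w)"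
        "Z = stack m1 n1 S0 T0"
        using stack_between[OF ssyt(1,3,2)] by blast
      then have "S0 \<in> interval ?r1 S U" "T0 \<in> interval ?r2 T V"
        using Z ssyt by (auto simp: interval_def crystal_order_stack_iff)
      then show "Z \<in> ?J"
        using ST0(3) by blast
    qed
    show "?J \<subseteq> ?I"
    proof clarify
      fix A B assume "A \<in> interval ?r1 S U" "B \<in> interval ?r2 T V"
      moreover from this have "A \<in> ssyt n1 (replicate m1 w)" "B \<in> ssyt n2 (replicate m2 w)"
        by (auto simp: interval_def crystal_order_def)
      ultimately show "stack m1 n1 A B \<in> ?I"
        using ssyt by (simp add: interval_def crystal_order_stack_iff)
    qed
  qed
qed (rule Partial_order_crystal_order finite_interval_crystal_order)+

section \<open>An interval with Moebius function 2\<close>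

text \<open>
  The sixteen tableaux entrywise between 112/234 and 123/344; the flags say which of the
  cells \<open>(1,0), (0,1), (0,2), (1,1)\<close> have been increased.
\<close>

definition cube :: "bool \<Rightarrow> bool \<Rightarrow> bool \<Rightarrow> bool \<Rightarrow> tableau" where
  "cube p q r s = (\<lambda>_. 0)
     ((0, 0) := 1, (0, 1) := if q then 2 else 1, (0, 2) := if r then 3 else 2,
      (1, 0) := if p then 3 else 2, (1, 1) := if s then 4 else 3, (1, 2) := 4)"

definition two_rows :: "nat list" where
  "two_rows = replicate 2 3"

lemma cube_inject [simp]:
  "cube p q r s = cube p' q' r' s' \<longleftrightarrow> p = p' \<and> q = q' \<and> r = r' \<and> s = s'"
proof
  assume eq: "cube p q r s = cube p' q' r' s'"
  show "p = p' \<and> q = q' \<and> r = r' \<and> s = s'"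
    using fun_cong[OF eq, of "(1, 0)"] fun_cong[OF eq, of "(0, 1)"] fun_cong[OF eq, of "(0, 2)"]
      fun_cong[OF eq, of "(1, 1)"]
    by (simp add: cube_def split: if_splits)
qed simp

text \<open>The possible entries are 1, 1-2, 2-3 in the top row and 2-3, 3-4, 4 in the bottom row;
  these ranges are compatible for every choice of flags.\<close>

lemma cube_ssyt: "cube p q r s \<in> ssyt 4 two_rows"
  unfolding two_rows_def ssyt_rect_iff by (auto simp: cube_def less_Suc_eq numeral_2_eq_2 numeral_3_eq_3)

section \<open>Covering relations inside the cube\<close>

lemma reading_cells_two_rows: "reading_cells two_rows = [(1, 0), (0, 0), (1, 1), (0, 1), (1, 2), (0, 2)]"
  unfolding two_rows_def reading_cells_rect by (simp add: upt_rec)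

text \<open>The updated tableau determines both the cell and the index of the operator, so the
  existential over indices collapses and a step is decided by one evaluation of the signature
  rule.\<close>

lemma crystal_step_update_iff:
  assumes "T \<in> ssyt n lam" "i \<in> {1..<n}" "T x = i"
  shows "(T, T(x := Suc i)) \<in> crystal_step n lam \<longleftrightarrow>
    plus_cells lam i T \<noteq> [] \<and> last (plus_cells lam i T) = x"
proof -
  have upd: "y = x \<and> k = i" if "T(x := Suc i) = T(y := Suc k)" "T y = k" for y k
    using assms(3) that by (metis fun_upd_apply n_not_Suc_n)
  have "k = i" if "crystal_f lam k T = Some (T(x := Suc i))" for k
    using that by (rule crystal_f_SomeE) (use upd in blast)
  then have "(T, T(x := Suc i)) \<in> crystal_step n lam \<longleftrightarrow> crystal_f lam i T = Some (T(x := Suc i))"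
    using assms(1,2) by (auto simp: crystal_step_def)
  also have "\<dots> \<longleftrightarrow> plus_cells lam i T \<noteq> [] \<and> last (plus_cells lam i T) = x"
    using assms(3) by (auto simp: crystal_f_plus_cells) (metis fun_upd_apply n_not_Suc_n)
  finally show ?thesis .
qed

lemma cube_updates:
  "cube True q r s = (cube False q r s)((1, 0) := Suc 2)"
  "cube p True r s = (cube p False r s)((0, 1) := Suc 1)"
  "cube p q True s = (cube p q False s)((0, 2) := Suc 2)"
  "cube p q r True = (cube p q r False)((1, 1) := Suc 3)"
  by (auto simp: cube_def fun_eq_iff)

text \<open>For the operators 1 and 3 the cell of flag \<open>q\<close> or \<open>s\<close> always
  carries the last uncancelled plus. The flags \<open>p\<close> and \<open>r\<close> both belong to
  the operator 2, whose signature depends on all four flags; hence the side conditions.\<close>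

lemma crystal_step_cube:
  "(cube False q r s, cube True q r s) \<in> crystal_step 4 two_rows \<longleftrightarrow> (if s then \<not> q \<and> r else q \<longrightarrow> r)"
  "(cube p False r s, cube p True r s) \<in> crystal_step 4 two_rows"
  "(cube p q False s, cube p q True s) \<in> crystal_step 4 two_rows \<longleftrightarrow> \<not> p \<and> s \<or> q \<and> p = s"
  "(cube p q r False, cube p q r True) \<in> crystal_step 4 two_rows"
  unfolding cube_updates
  by (subst crystal_step_update_iff, rule cube_ssyt, simp, simp add: cube_def,
      cases p; cases q; cases r; cases s;
      simp add: plus_cells_def signature_def reading_cells_two_rows cancel_def cube_def)+

text \<open>A predecessor lowers one entry by 1. To stay above the bottom tableau it must lower a
  cell whose flag is set, so it remains in the cube.\<close>

lemma crystal_step_into_cubeE: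
  assumes step: "(T, cube p q r s) \<in> crystal_step 4 two_rows"
    and le: "\<And>x. cube False False False False x \<le> T x"
  obtains "p" "T = cube False q r s" | "q" "T = cube p False r s" | "r" "T = cube p q False s"
    | "s" "T = cube p q r False"
proof -
  obtain i x where x: "x \<in> diagram two_rows" "T x = i" "cube p q r s = T(x := Suc i)"
    using step by (auto simp: crystal_step_def elim: crystal_f_SomeE)
  then have T: "T = (cube p q r s)(x := i)" and cx: "cube p q r s x = Suc i"
    by auto
  have "x \<in> {(0, 0), (0, 1), (0, 2), (1, 0), (1, 1), (1, 2)}"
    using x(1) unfolding two_rows_def diagram_rect by (auto simp: less_Suc_eq numeral_2_eq_2 numeral_3_eq_3)
  moreover have "cube False False False False x \<le> i"
    using le[of x] x(2) by simp
  ultimately have "p \<and> x = (1, 0) \<or> q \<and> x = (0, 1) \<or> r \<and> x = (0, 2) \<or> s \<and> x = (1, 1)"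
    using cx by (auto simp: cube_def split: if_splits)
  then show thesis
  proof (elim disjE conjE)
    assume "p" "x = (1, 0)"
    then show thesis
      using that(1) T cx by (auto simp: cube_def fun_eq_iff)
  next
    assume "q" "x = (0, 1)"
    then show thesis
      using that(2) T cx by (auto simp: cube_def fun_eq_iff)
  next
    assume "r" "x = (0, 2)"
    then show thesis
      using that(3) T cx by (auto simp: cube_def fun_eq_iff)
  next
    assume "s" "x = (1, 1)"
    then show thesis
      using that(4) T cx by (auto simp: cube_def fun_eq_iff)
  qed
qed

section \<open>Computing intervals and the value 2\<close>

text \<open>Splits a chain at its last step. If no predecessor of \<open>T\<close> lies above
  \<open>S\<close>, then neither does \<open>T\<close>, and both sides are empty.\<close>

lemma interval_crystal_order_rec:
  assumes "T \<in> ssyt n lam" "S \<noteq> T"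
  shows "interval (crystal_order n lam) S T =
    (\<Union>U\<in>{U. (U, T) \<in> crystal_step n lam \<and> (S, U) \<in> crystal_order n lam}.
       insert T (interval (crystal_order n lam) S U))" (is "?I = ?J")
proof
  let ?r = "crystal_order n lam"
  show "?I \<subseteq> ?J"
  proof
    fix Z assume "Z \<in> ?I"
    then have Z: "(S, Z) \<in> ?r" "(Z, T) \<in> ?r" by (auto simp: interval_def)
    show "Z \<in> ?J"
    proof (cases "Z = T")
      case True
      then have "(S, T) \<in> (crystal_step n lam)\<^sup>*" "S \<in> ssyt n lam"
        using Z by (auto simp: crystal_order_def)
      then obtain U where "(S, U) \<in> (crystal_step n lam)\<^sup>*" "(U, T) \<in> crystal_step n lam"
        using \<open>S \<noteq> T\<close> by (auto elim: rtranclE)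
      then show ?thesis
        using True \<open>S \<in> ssyt n lam\<close> by (auto simp: crystal_order_def crystal_step_def)
    next
      case False
      then obtain U where U: "(Z, U) \<in> (crystal_step n lam)\<^sup>*" "(U, T) \<in> crystal_step n lam"
        using Z by (auto simp: crystal_order_def elim: rtranclE)
      then have "(Z, U) \<in> ?r"
        using Z by (auto simp: crystal_order_def crystal_step_def)
      moreover from this have "(S, U) \<in> ?r"
        using Z by (auto simp: crystal_order_def)
      ultimately show ?thesis
        using U Z by (auto simp: interval_def)
    qed
  qed
  show "?J \<subseteq> ?I"
    using assms(1) by (auto simp: interval_def crystal_order_def intro: rtrancl_into_rtrancl)
qed

abbreviation "cube_down p q r s \<equiv>
  interval (crystal_order 4 two_rows) (cube False False False False) (cube p q r s)"

lemma cube_down_bot: "cube_down False False False False = {cube False False False False}"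
  by (rule interval_self[OF Partial_order_crystal_order]) (simp add: crystal_order_def cube_ssyt)

text \<open>A rewrite rule that clears one flag at a time, so it ends at
  \<open>cube_down_bot\<close>. An empty result means that the tableau is not above the
  bottom.\<close>

lemma cube_down_rec:
  assumes "p \<or> q \<or> r \<or> s"
  defines "D \<equiv> (if p \<and> (if s then \<not> q \<and> r else q \<longrightarrow> r) then cube_down False q r s else {}) \<union>
    (if q then cube_down p False r s else {}) \<union>
    (if r \<and> (\<not> p \<and> s \<or> q \<and> p = s) then cube_down p q False s else {}) \<union>
    (if s then cube_down p q r False else {})"
  shows "cube_down p q r s = (if D = {} then {} else insert (cube p q r s) D)"
proof -
  let ?r = "crystal_order 4 two_rows" and ?E = "crystal_step 4 two_rows"
  let ?bot = "cube False False False False"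
  have self: "T \<in> interval ?r ?bot T" if "(?bot, T) \<in> ?r" for T
    using that by (auto simp: interval_def crystal_order_def)
  have above: "(?bot, T) \<in> ?r" if "X \<in> interval ?r ?bot T" for X T
    using that by (auto simp: interval_def crystal_order_def)
  let ?U = "{U. (U, cube p q r s) \<in> ?E \<and> (?bot, U) \<in> ?r}"
  have "?U = {U. (?bot, U) \<in> ?r \<and>
      (p \<and> (if s then \<not> q \<and> r else q \<longrightarrow> r) \<and> U = cube False q r s \<or>
       q \<and> U = cube p False r s \<or>
       r \<and> (\<not> p \<and> s \<or> q \<and> p = s) \<and> U = cube p q False s \<or>
       s \<and> U = cube p q r False)}"
    (is "_ = ?V")
  proof
    show "?U \<subseteq> ?V"
    proof
      fix T assume "T \<in> ?U"
      then have T: "(T, cube p q r s) \<in> ?E" "(?bot, T) \<in> ?r" by auto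
      then have "?bot x \<le> T x" for x
        by (auto simp: crystal_order_def crystal_steps_mono)
      from T(1) this show "T \<in> ?V"
        by (rule crystal_step_into_cubeE) (use T crystal_step_cube in auto)
    qed
    show "?V \<subseteq> ?U"
      using crystal_step_cube by auto
  qed
  then have D: "D = (\<Union>U\<in>?U. interval ?r ?bot U)"
    using above unfolding D_def by auto
  \<comment> \<open>Every predecessor above the bottom belongs to its own interval, so it
    contributes at least one element.\<close>
  then have "D = {} \<longleftrightarrow> ?U = {}"
    using self by blast
  then show ?thesis
    using D assms(1) interval_crystal_order_rec[OF cube_ssyt[of p q r s], of ?bot] by auto
qed

lemma mobius_crystal_order:
  assumes "S \<noteq> T" "T \<in> interval (crystal_order n lam) S T"
  shows "mobius (crystal_order n lam) S T =
    - (\<Sum>Z\<in>interval (crystal_order n lam) S T - {T}. mobius (crystal_order n lam) S Z)"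
  using assms Partial_order_crystal_order[of n lam] finite_interval_crystal_order[of n lam S T]
  by (subst mobius.simps) (auto simp: interval_def)

text \<open>These are all elements of the final interval except the bottom. Of the other flag
  vectors, 0010 and 1010 are not above the bottom, while 0101 and 0111 are not below the
  top.\<close>

lemma cube_downs:
  "cube_down False False False True = {cube False False False False, cube False False False True}"
  "cube_down True False False False = {cube False False False False, cube True False False False}"
  "cube_down False True False False = {cube False False False False, cube False True False False}"
  "cube_down True False False True =
    {cube False False False False, cube True False False False, cube True False False True}"
  "cube_down False False True True =
    {cube False False False False, cube False False False True, cube False False True True}"
  "cube_down True True False False =
    {cube False False False False, cube True False False False, cube True True False False}"
  "cube_down False True True False =
    {cube False False False False, cube False True False False, cube False True True False}"
  "cube_down True False True True =
    {cube False False False False, cube False False False True, cube False False True True,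
     cube True False True True}"
  "cube_down True True False True =
    {cube False False False False, cube True False False False, cube True False False True,
     cube True True False False, cube True True False True}"
  "cube_down True True True False =
    {cube False False False False, cube False True False False, cube False True True False,
     cube True True True False}"
  "cube_down True True True True =
    {cube False False False False, cube False False False True, cube True False False False,
     cube False True False False, cube True False False True, cube False False True True,
     cube True True False False, cube False True True False, cube True False True True,
     cube True True False True, cube True True True False, cube True True True True}"
  by (simp_all add: cube_down_rec cube_down_bot insert_commute)

text \<open>The open interval consists of the chains 0001, 0011, 1011 and 0100, 0110, 1110 and the
  diamond 1000, 1001, 1100, 1101. The least element of each component has value -1 and the others
  have value 0, so the top gets -(1 - 3) = 2.\<close>

lemma mobius_cube:
  "mobius (crystal_order 4 two_rows) (cube False False False False) (cube True True True True) = 2"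
proof -
  let ?\<mu> = "mobius (crystal_order 4 two_rows) (cube False False False False)"
  note rec = mobius_crystal_order[of "cube False False False False"]
  have "(cube False False False False, cube False False False False) \<in> crystal_order 4 two_rows"
    by (simp add: crystal_order_def cube_ssyt)
  then have "?\<mu> (cube False False False False) = 1"
    using sum_mobius_interval[OF Partial_order_crystal_order finite_interval_crystal_order]
    by (fastforce simp: cube_down_bot)
  moreover from this have "?\<mu> (cube False False False True) = - 1" "?\<mu> (cube True False False False) = - 1"
    "?\<mu> (cube False True False False) = - 1"
    by (simp_all add: rec cube_downs insert_Diff_if)
  moreover from calculation have "?\<mu> (cube True False False True) = 0" "?\<mu> (cube False False True True) = 0"
    "?\<mu> (cube True True False False) = 0" "?\<mu> (cube False True True False) = 0"
    by (simp_all add: rec cube_downs insert_Diff_if)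
  moreover from calculation have "?\<mu> (cube True False True True) = 0" "?\<mu> (cube True True False True) = 0"
    "?\<mu> (cube True True True False) = 0"
    by (simp_all add: rec cube_downs insert_Diff_if)
  ultimately show ?thesis
    by (simp add: rec cube_downs insert_Diff_if)
qed

lemma cube_bot_le_top:
  "(cube False False False False, cube True True True True) \<in> crystal_order 4 two_rows"
proof -
  have "cube True True True True \<in> cube_down True True True True"
    by (simp add: cube_downs)
  then show ?thesis
    by (auto simp: interval_def crystal_order_def)
qed

text \<open>Each round stacks one more copy of the cube interval on top, adding 4 letters and 2 rows
  while the width stays 3. A single copy is the case \<open>k = 0\<close>, whence the exponent
  \<open>Suc k\<close>.\<close>

lemma ex_mobius_power:
  "\<exists>n m u v. 2 \<le> n \<and> (u, v) \<in> crystal_order n (replicate m 3) \<and>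
     mobius (crystal_order n (replicate m 3)) u v = 2 ^ Suc k"
proof (induction k)
  case 0
  show ?case
    using cube_bot_le_top mobius_cube unfolding two_rows_def
    by (intro exI[of _ "4::nat"] exI[of _ "2::nat"] exI conjI) auto
next
  case (Suc k)
  then obtain n m u v where IH: "2 \<le> n" "(u, v) \<in> crystal_order n (replicate m 3)"
    "mobius (crystal_order n (replicate m 3)) u v = 2 ^ Suc k"
    by blast
  let ?u = "cube False False False False" and ?v = "cube True True True True"
  note le = cube_bot_le_top[unfolded two_rows_def]
  have "mobius (crystal_order (4 + n) (replicate (2 + m) 3)) (stack 2 4 ?u u) (stack 2 4 ?v v) = 2 * 2 ^ Suc k"
    using mobius_stack[OF le IH(2)] mobius_cube IH(3) by (simp only: two_rows_def)
  moreover have "(stack 2 4 ?u u, stack 2 4 ?v v) \<in> crystal_order (4 + n) (replicate (2 + m) 3)"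
    using le IH(2) by (subst crystal_order_stack_iff) (auto simp: crystal_order_def)
  ultimately show ?case
    using IH(1) by (intro exI[of _ "4 + n"] exI[of _ "2 + m"] exI conjI) (assumption | simp)+
qed

theorem theorem7p3:
  fixes N :: int
  shows "\<exists>n lam u v. 2 \<le> n \<and> is_partition lam \<and> u \<in> ssyt n lam \<and> v \<in> ssyt n lam \<and>
           (u, v) \<in> crystal_order n lam \<and> mobius (crystal_order n lam) u v \<ge> N"
proof -
  obtain n m u v where uv: "2 \<le> n" "(u, v) \<in> crystal_order n (replicate m 3)"
    "mobius (crystal_order n (replicate m 3)) u v = 2 ^ Suc (nat N)"
    using ex_mobius_power by blast
  \<comment> \<open>\<open>nat N\<close> is 0 for negative \<open>N\<close>, so \<open>N\<close> is
    below \<open>Suc (nat N)\<close> for every integer.\<close>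
  have "int (Suc (nat N)) < int (2 ^ Suc (nat N))"
    by (simp only: of_nat_less_iff less_exp)
  then have "N \<le> mobius (crystal_order n (replicate m 3)) u v"
    unfolding uv(3) of_nat_power of_nat_numeral by linarith
  moreover have "is_partition (replicate m 3)"
    by (simp add: is_partition_def sorted_wrt_iff_nth_less)
  moreover have "u \<in> ssyt n (replicate m 3)" "v \<in> ssyt n (replicate m 3)"
    using uv(2) by (auto simp: crystal_order_def)
  ultimately show ?thesis
    using uv by blast
qed

end
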